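(* Let $DP=\{(a_i,-b_i)\}_{i=1}^n\subset\mathbb{R}^2$ be the finite set of points dual to the constraints $a_ix+b_i\le t$, $i=1,\dots,n$. Suppose $DP$ is partitioned into two nonempty sets, $L$ (the points with negative first coordinate) and $R$ (the points with positive first coordinate). Let $p_0\in L$ be arbitrary. Then the alternating iteration described in the context, started at $p_0$, terminates after finitely many steps.
   Context: The problem considered is: minimize $t$ over $(x,t)\in\mathbb{R}^2$ subject to $a_ix+b_i\le t$ for $i=1,\dots,n$. The constraint $a_ix+b_i\le t$ is transformed into the dual point $(a_i,-b_i)$. The alternating iteration (Step 4 of the algorithm), started at $p_0\in L$, is: repeat until no change, given $p_i$ in $L$ (respectively in $R$), find a point $p_{i+1}$ in $R$ (respectively in $L$) with the largest clockwise (respectively counter-clockwise) turn as seen from $p_i$. Explicitly: - If $p_i\in L$, then $p_{i+1}\in R$ is chosen so that the line through $p_i$ and $p_{i+1}$ has the smallest slope among all lines through $p_i$ and a point of $R$. - If $p_i\in R$, then $p_{i+1}\in L$ is chosen so that the line through $p_i$ and $p_{i+1}$ has the largest slope among all lines through $p_i$ and a point of $L$. Tie convention: for $i\ge 1$, if the previous point $p_{i-1}$ is itself among the optimal choices for $p_{i+1}$ (no point gives a strictly larger turn), then $p_{i+1}=p_{i-1}$. Other ties are broken arbitrarily. "No change" means $p_{i+1}=p_{i-1}$ for some $i\ge1$, and the iteration then terminates. *)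

theory Defs
  imports Complex_Main
begin

type_synonym point = "real \<times> real"

definition dual_points :: "nat \<Rightarrow> (nat \<Rightarrow> real) \<Rightarrow> (nat \<Rightarrow> real) \<Rightarrow> point set" where
  "dual_points n a b = (\<lambda>i. (a i, - b i)) ` {1..n}"

definition slope :: "point \<Rightarrow> point \<Rightarrow> real" where
  "slope p q = (snd q - snd p) / (fst q - fst p)"

text \<open>Only used with \<open>L\<close> strictly left and \<open>R\<close> strictly right of the vertical axis,
  so \<open>L\<close> and \<open>R\<close> are disjoint and no slope below has a zero denominator.\<close>

definition optimal_choices :: "point set \<Rightarrow> point set \<Rightarrow> point \<Rightarrow> point set" where
  "optimal_choices L R p =
     {q. (p \<in> L \<and> q \<in> R \<and> (\<forall>r\<in>R. slope p q \<le> slope p r)) \<or>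
         (p \<in> R \<and> q \<in> L \<and> (\<forall>r\<in>L. slope p r \<le> slope p q))}"

definition no_change :: "point list \<Rightarrow> nat \<Rightarrow> bool" where
  "no_change ps i \<longleftrightarrow> 1 \<le> i \<and> Suc i < length ps \<and> ps ! Suc i = ps ! (i - 1)"

text \<open>\<open>is_run L R p0 ps\<close>: the list \<open>ps = [p\<^sub>0, \<dots>, p\<^sub>N]\<close> is a (possibly still incomplete)
  execution of the iteration, for some way of breaking the ties that the convention leaves free.
  The last clause says that nothing is computed after the first \<open>no change\<close>.\<close>

definition is_run :: "point set \<Rightarrow> point set \<Rightarrow> point \<Rightarrow> point list \<Rightarrow> bool" where
  "is_run L R p0 ps \<longleftrightarrow>
     ps \<noteq> [] \<and> ps ! 0 = p0 \<and>
     (\<forall>i. Suc i < length ps \<longrightarrow> ps ! Suc i \<in> optimal_choices L R (ps ! i)) \<and>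
     (\<forall>i\<ge>1. Suc i < length ps \<longrightarrow> ps ! (i - 1) \<in> optimal_choices L R (ps ! i)
        \<longrightarrow> ps ! Suc i = ps ! (i - 1)) \<and>
     (\<forall>i. no_change ps i \<longrightarrow> length ps = Suc (Suc i))"

text \<open>Since ties make the iteration nondeterministic, termination means that no execution
  goes on forever and that an execution can only come to an end by reaching \<open>no change\<close>
  (it never gets stuck for lack of an admissible next point).\<close>

definition iteration_terminates :: "point set \<Rightarrow> point set \<Rightarrow> point \<Rightarrow> bool" where
  "iteration_terminates L R p0 \<longleftrightarrow>
     (\<nexists>p. \<forall>N. is_run L R p0 (map p [0..<Suc N])) \<and>
     (\<forall>ps. is_run L R p0 ps \<and> (\<nexists>i. no_change ps i) \<longrightarrow> (\<exists>q. is_run L R p0 (ps @ [q])))"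

end

theory Submission
  imports Defs
begin

text \<open>
  The alternating iteration is a descent method for one real quantity: the height at which the
  line through two consecutive points crosses the vertical axis.  Seen from a point left of the
  axis, a line turned clockwise meets the axis lower; seen from a point right of the axis, the
  same holds for a line turned counter-clockwise.  So both rules, smallest slope towards \<open>R\<close> and
  largest slope towards \<open>L\<close>, choose the opposite point whose connecting line has the lowest
  crossing (lemma \<open>optimal_choices_iff\<close>).

  The crossing height does not depend on the order of the two points, so the previous point always
  competes for the role of the next one.  Hence the heights never increase, and by the tie
  convention they stay equal only if the iteration returns to the previous point, which
  is termination (lemma \<open>height_decreases\<close>).  Finitely many points span finitely many lines, so a
  run cannot decrease the height forever.  Conversely, no run gets stuck, because a minimum over a
  finite nonempty set is attained.
\<close>

definition crossing_height :: "point \<Rightarrow> point \<Rightarrow> real" where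
  "crossing_height p q = snd p - fst p * slope p q"

lemma crossing_height_commute:
  assumes "fst p \<noteq> fst q"
  shows "crossing_height p q = crossing_height q p"
  using assms by (simp add: crossing_height_def slope_def field_simps)

text \<open>Appending to a run without \<open>no change\<close> can create one only at the last index, where the
  definition of a run permits it.\<close>

lemma is_run_snoc:
  assumes run: "is_run L R p0 ps" and unfinished: "\<nexists>i. no_change ps i"
    and optimal: "q \<in> optimal_choices L R (last ps)"
    and tie: "\<And>k. \<lbrakk>length ps = Suc (Suc k); ps ! k \<in> optimal_choices L R (last ps)\<rbrakk>
      \<Longrightarrow> q = ps ! k"
  shows "is_run L R p0 (ps @ [q])"
proof -
  obtain m where m: "length ps = Suc m"
    using run by (cases ps) (auto simp: is_run_def)
  have last: "last ps = ps ! m"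
    using m by (metis diff_Suc_1 last_conv_nth length_0_conv nat.distinct(1))
  have old: "(ps @ [q]) ! i = ps ! i" if "i \<le> m" for i
    using that m by (simp add: nth_append)
  have new: "(ps @ [q]) ! Suc m = q"
    using m by (metis nth_append_length)
  have len: "length (ps @ [q]) = Suc (Suc m)"
    using m by simp
  show ?thesis
    unfolding is_run_def
  proof (intro conjI allI impI)
    show "ps @ [q] \<noteq> []" by simp
    show "(ps @ [q]) ! 0 = p0"
      using run old[of 0] by (simp add: is_run_def)
  next
    fix i assume "Suc i < length (ps @ [q])"
    then have "i < m \<or> i = m" using m by auto
    then show "(ps @ [q]) ! Suc i \<in> optimal_choices L R ((ps @ [q]) ! i)"
    proof
      assume "i < m"
      then show ?thesis using run m old[of i] old[of "Suc i"] by (simp add: is_run_def)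
    next
      assume "i = m"
      then show ?thesis using optimal last old[of m] new by simp
    qed
  next
    fix i assume i: "1 \<le> i" "Suc i < length (ps @ [q])"
      and prev: "(ps @ [q]) ! (i - 1) \<in> optimal_choices L R ((ps @ [q]) ! i)"
    have "i < m \<or> i = m" using i m by auto
    then show "(ps @ [q]) ! Suc i = (ps @ [q]) ! (i - 1)"
    proof
      assume "i < m"
      then show ?thesis
        using run m i(1) prev old[of "i - 1"] old[of i] old[of "Suc i"]
        by (simp add: is_run_def)
    next
      assume "i = m"
      then obtain k where "m = Suc k" using i(1) by (cases m) auto
      then show ?thesis
        using tie[of k] prev \<open>i = m\<close> last m old[of k] old[of m] new by simp
    qed
  next
    fix i assume change: "no_change (ps @ [q]) i"
    have "\<not> i < m"
    proof
      assume "i < m"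
      then have "no_change ps i"
        using change m old[of "i - 1"] old[of "Suc i"] by (simp add: no_change_def)
      then show False using unfinished by blast
    qed
    then have "i = m" using change m by (simp add: no_change_def)
    then show "length (ps @ [q]) = Suc (Suc i)" using len by simp
  qed
qed

locale separated_points =
  fixes L R :: "point set"
  assumes finite_L: "finite L" and finite_R: "finite R"
    and L_nonempty: "L \<noteq> {}" and R_nonempty: "R \<noteq> {}"
    and L_left: "p \<in> L \<Longrightarrow> fst p < 0" and R_right: "p \<in> R \<Longrightarrow> fst p > 0"
begin

definition opposite :: "point \<Rightarrow> point set" where
  "opposite p = (if p \<in> L then R else L)"

lemma disjoint: "p \<in> L \<Longrightarrow> p \<notin> R"
  using L_left[of p] R_right[of p] by auto

lemma opposite_subset: "opposite p \<subseteq> L \<union> R"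
  by (auto simp: opposite_def)

lemma opposite_sym:
  assumes "p \<in> L \<union> R" "q \<in> opposite p"
  shows "p \<in> opposite q"
  using assms disjoint[of q] by (auto simp: opposite_def split: if_splits)

lemma crossing_height_opposite:
  assumes "p \<in> L \<union> R" "q \<in> opposite p"
  shows "crossing_height p q = crossing_height q p"
proof (rule crossing_height_commute)
  show "fst p \<noteq> fst q"
    using assms L_left[of p] L_left[of q] R_right[of p] R_right[of q]
    by (auto simp: opposite_def split: if_splits)
qed

text \<open>For a fixed first point \<open>p\<close> the crossing height is an affine function of the slope with
  coefficient \<open>- fst p\<close>.  Its sign changes with the side of \<open>p\<close>, which turns the two opposite
  rules into one minimisation.\<close>

lemma optimal_choices_iff:
  assumes "p \<in> L \<union> R"
  shows "q \<in> optimal_choices L R p \<longleftrightarrow>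
    q \<in> opposite p \<and> (\<forall>r\<in>opposite p. crossing_height p q \<le> crossing_height p r)"
proof (cases "p \<in> L")
  case True
  then have "crossing_height p q \<le> crossing_height p r \<longleftrightarrow> slope p q \<le> slope p r" for r
    using L_left[of p] by (simp add: crossing_height_def mult_le_cancel_left)
  then show ?thesis
    using True disjoint by (simp add: optimal_choices_def opposite_def)
next
  case False
  then have "p \<in> R" using assms by simp
  then have "crossing_height p q \<le> crossing_height p r \<longleftrightarrow> slope p r \<le> slope p q" for r
    using R_right[of p] by (simp add: crossing_height_def mult_le_cancel_left)
  then show ?thesis
    using False \<open>p \<in> R\<close> by (simp add: optimal_choices_def opposite_def)
qed

lemma optimal_choices_subset: "optimal_choices L R p \<subseteq> L \<union> R"
  by (auto simp: optimal_choices_def)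

lemma optimal_choices_nonempty:
  assumes "p \<in> L \<union> R"
  shows "optimal_choices L R p \<noteq> {}"
proof -
  have "finite (opposite p)" "opposite p \<noteq> {}"
    using finite_L finite_R L_nonempty R_nonempty by (auto simp: opposite_def)
  then obtain q where "is_arg_min (crossing_height p) (\<lambda>q. q \<in> opposite p) q"
    using ex_is_arg_min_if_finite by blast
  then show ?thesis
    using optimal_choices_iff[OF assms, of q] by (auto simp: is_arg_min_linorder)
qed

text \<open>The previous point \<open>p\<close> is one of the candidates seen from \<open>q\<close>, and its line is the current
  one.  If it is not optimal, every optimal candidate is strictly better.\<close>

lemma height_decreases:
  assumes "p \<in> L \<union> R" "q \<in> optimal_choices L R p" "r \<in> optimal_choices L R q"
    and "p \<notin> optimal_choices L R q"
  shows "crossing_height q r < crossing_height p q"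
proof -
  have q: "q \<in> opposite p" using assms optimal_choices_iff by blast
  have qLR: "q \<in> L \<union> R" using q opposite_subset by blast
  have "p \<in> opposite q" using assms(1) q by (rule opposite_sym)
  then obtain s where "s \<in> opposite q" "crossing_height q s < crossing_height q p"
    using assms(4) optimal_choices_iff[OF qLR] by (auto simp: not_le)
  moreover have "crossing_height q r \<le> crossing_height q s"
    using assms(3) optimal_choices_iff[OF qLR] \<open>s \<in> opposite q\<close> by blast
  ultimately show ?thesis
    using crossing_height_opposite[OF assms(1) q] by simp
qed

lemma no_infinite_run:
  assumes "p0 \<in> L \<union> R"
  shows "\<not> (\<forall>N. is_run L R p0 (map p [0..<Suc N]))"
proof
  assume run: "\<forall>N. is_run L R p0 (map p [0..<Suc N])"
  have nth: "map p [0..<Suc N] ! i = p i" if "i \<le> N" for i N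
    using that by (simp del: upt_Suc)
  have step: "p (Suc i) \<in> optimal_choices L R (p i)" for i
  proof -
    have "map p [0..<Suc (Suc i)] ! Suc i \<in> optimal_choices L R (map p [0..<Suc (Suc i)] ! i)"
      using run[rule_format, of "Suc i"] unfolding is_run_def by simp
    then show ?thesis by (simp only: nth le_refl le_SucI)
  qed
  have in_LR: "p i \<in> L \<union> R" for i
  proof (cases i)
    case 0
    have "map p [0..<Suc 0] ! 0 = p0"
      using run[rule_format, of 0] unfolding is_run_def by blast
    then show ?thesis using assms 0 by simp
  next
    case (Suc j)
    then show ?thesis using step optimal_choices_subset by blast
  qed
  have strict: "p i \<notin> optimal_choices L R (p (Suc i))" for i
  proof
    assume tie: "p i \<in> optimal_choices L R (p (Suc i))"
    \<comment> \<open>The point of index \<open>i + 2\<close> returns to that of index \<open>i\<close>; one point more is then too many.\<close>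
    define ps where "ps = map p [0..<Suc (Suc (Suc (Suc i)))]"
    have len: "length ps = Suc (Suc (Suc (Suc i)))"
      by (simp add: ps_def)
    have vals: "ps ! i = p i" "ps ! Suc i = p (Suc i)"
      unfolding ps_def by (rule nth, simp)+
    have is_run: "is_run L R p0 ps" using run ps_def by blast
    then have "ps ! Suc (Suc i) = ps ! i"
      using tie vals len unfolding is_run_def
      by (metis One_nat_def Suc_le_mono diff_Suc_1 le0 lessI less_SucI)
    then have "no_change ps (Suc i)"
      using len by (simp add: no_change_def)
    then have "length ps = Suc (Suc (Suc i))"
      using is_run unfolding is_run_def by blast
    then show False using len by simp
  qed
  define h where "h i = crossing_height (p i) (p (Suc i))" for i
  have "h (Suc i) < h i" for i
    unfolding h_def using height_decreases in_LR step strict by blast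
  then have "strict_mono (\<lambda>i. - h i)"
    by (simp add: strict_mono_Suc_iff)
  then have "inj (\<lambda>i. - h i)"
    by (rule strict_mono_imp_inj_on)
  then have "inj h"
    by (simp add: inj_on_def)
  moreover have "range h \<subseteq> (\<lambda>(x, y). crossing_height x y) ` ((L \<union> R) \<times> (L \<union> R))"
    using in_LR by (force simp: h_def)
  then have "finite (range h)"
    using finite_L finite_R by (meson finite_SigmaI finite_UnI finite_imageI finite_subset)
  ultimately show False
    using finite_imageD infinite_UNIV_nat by blast
qed

lemma unfinished_run_extends:
  assumes "p0 \<in> L \<union> R" and run: "is_run L R p0 ps" and unfinished: "\<nexists>i. no_change ps i"
  shows "\<exists>q. is_run L R p0 (ps @ [q])"
proof -
  have "last ps \<in> L \<union> R"
  proof (cases "length ps = 1")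
    case True
    then show ?thesis
      using run assms(1) by (simp add: is_run_def last_conv_nth)
  next
    case False
    then obtain k where k: "length ps = Suc (Suc k)"
      using run by (metis One_nat_def is_run_def length_0_conv not0_implies_Suc)
    then have "last ps = ps ! Suc k"
      by (metis diff_Suc_1 last_conv_nth length_0_conv nat.distinct(1))
    moreover have "ps ! Suc k \<in> optimal_choices L R (ps ! k)"
      using run k by (simp add: is_run_def)
    ultimately show ?thesis by (metis optimal_choices_subset subsetD)
  qed
  then obtain r where r: "r \<in> optimal_choices L R (last ps)"
    using optimal_choices_nonempty by blast
  show ?thesis
  proof (cases "\<exists>k. length ps = Suc (Suc k) \<and> ps ! k \<in> optimal_choices L R (last ps)")
    case True
    then obtain k where "length ps = Suc (Suc k)" "ps ! k \<in> optimal_choices L R (last ps)"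
      by blast
    then have "is_run L R p0 (ps @ [ps ! k])"
      by (intro is_run_snoc[OF run unfinished]) simp_all
    then show ?thesis ..
  next
    case False
    then have "is_run L R p0 (ps @ [r])"
      by (intro is_run_snoc[OF run unfinished r]) blast
    then show ?thesis ..
  qed
qed

lemma iteration_terminates:
  assumes "p0 \<in> L \<union> R"
  shows "iteration_terminates L R p0"
  using no_infinite_run[OF assms] unfinished_run_extends[OF assms]
  by (auto simp: iteration_terminates_def simp del: upt_Suc)

end

theorem claim5:
  fixes n :: nat and a b :: "nat \<Rightarrow> real" and DP L R :: "point set" and p0 :: point
  assumes "DP = dual_points n a b"
    and "L = {p \<in> DP. fst p < 0}"
    and "R = {p \<in> DP. fst p > 0}"
    and "DP = L \<union> R"
    and "L \<noteq> {}" and "R \<noteq> {}"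
    and "p0 \<in> L"
  shows "iteration_terminates L R p0"
proof -
  have "finite DP" using assms(1) by (simp add: dual_points_def)
  then interpret separated_points L R
    using assms(2,3,5,6) by unfold_locales auto
  show ?thesis using iteration_terminates assms(7) by blast
qed

end
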